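(* Every Tits homomorphism is a morphism in $\mathscr{Ast}$: for every Coxeter matrix $M=(m_{ij})_{i,j\in I}$ over a finite set $I$ and every $\mathbf d=(d_i)_{i\in I}\in\mathbb Z_{>0}^I$, the homomorphism $\mathbf T_{\mathbf d}:\mathrm{Br}^+(M(\mathbf d))\to\mathrm{Br}^+(M)$, $\widehat T_i\mapsto T_i^{d_i}$, $i\in I$, is a composition of standard homomorphisms of Artin monoids.
   Context: A Coxeter matrix over a finite set $I$ is a symmetric matrix $M=(m_{ij})_{i,j\in I}$ with $m_{ii}=1$ and $m_{ij}\in\mathbb Z_{\ge2}\cup\{\infty\}$ for $i\ne j$. $\mathrm{Br}^+(M)$ is the Artin monoid: generators $T_i$, $i\in I$, relations $T_iT_jT_i\cdots=T_jT_iT_j\cdots$ ($m_{ij}$ factors each) for $i\ne j$, $m_{ij}<\infty$. Given $\mathbf d\in\mathbb Z_{>0}^I$, the Coxeter matrix $M(\mathbf d)=(m_{ij}(\mathbf d))_{i,j\in I}$ is defined by $m_{ij}(\mathbf d)=m_{ij}$ if $m_{ij}\le2$ or $d_id_j=1$; $m_{ij}(\mathbf d)=2d_id_j$ if $m_{ij}=3$ and $d_id_j\in\{2,3\}$; $m_{ij}(\mathbf d)=\infty$ otherwise. Generators of $\mathrm{Br}^+(M(\mathbf d))$ are denoted $\widehat T_i$; the assignments $\widehat T_i\mapsto T_i^{d_i}$ define a homomorphism $\mathbf T_{\mathbf d}$, called a Tits homomorphism. For an element $w$ of the Coxeter group $W(M)$ with reduced expression $s_{i_1}\cdots s_{i_k}$,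 $T_w=T_{i_1}\cdots T_{i_k}$. $J\subset I$ is of finite type if the parabolic subgroup $W_J(M)$ is finite, and then $w_\circ^J$ is its longest element. A homomorphism $\Phi:\mathrm{Br}^+(M_1)\to\mathrm{Br}^+(M_2)$ is standard if every generator of $\mathrm{Br}^+(M_1)$ is mapped to $T_{w_\circ^J}$ for some finite type subset $J$ of the index set of $M_2$ (depending on the generator). $\mathscr{Ast}$ is the category whose objects are Coxeter matrices and whose morphisms are compositions of standard homomorphisms of the corresponding Artin monoids. *)

theory Defs
  imports "HOL-Library.Extended_Nat" "HOL-Algebra.Generated_Groups"
begin

section \<open>Monoids given by generators and relations\<close>

text \<open>The congruence on the free monoid of words over \<open>I\<close> generated by a set \<open>R\<close> of pairs of
  words over \<open>I\<close>.\<close>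

inductive_set word_cong :: "'a set \<Rightarrow> ('a list \<times> 'a list) set \<Rightarrow> ('a list \<times> 'a list) set"
  for I R where
  refl: "w \<in> lists I \<Longrightarrow> (w, w) \<in> word_cong I R"
| sym: "(u, v) \<in> word_cong I R \<Longrightarrow> (v, u) \<in> word_cong I R"
| trans: "(u, v) \<in> word_cong I R \<Longrightarrow> (v, w) \<in> word_cong I R \<Longrightarrow> (u, w) \<in> word_cong I R"
| rel: "(x, y) \<in> R \<Longrightarrow> u \<in> lists I \<Longrightarrow> v \<in> lists I \<Longrightarrow> (u @ x @ v, u @ y @ v) \<in> word_cong I R"

definition word_class :: "'a set \<Rightarrow> ('a list \<times> 'a list) set \<Rightarrow> 'a list \<Rightarrow> 'a list set" where
  "word_class I R w = word_cong I R `` {w}"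

definition presented_monoid :: "'a set \<Rightarrow> ('a list \<times> 'a list) set \<Rightarrow> 'a list set monoid" where
  "presented_monoid I R =
    \<lparr> carrier = lists I // word_cong I R,
      mult = (\<lambda>X Y. \<Union>u\<in>X. \<Union>v\<in>Y. word_class I R (u @ v)),
      one = word_class I R [] \<rparr>"

context
  fixes I :: "'a set" and R :: "('a list \<times> 'a list) set"
  assumes R: "R \<subseteq> lists I \<times> lists I"
begin

lemma word_cong_lists: "(u, v) \<in> word_cong I R \<Longrightarrow> u \<in> lists I \<and> v \<in> lists I"
  by (induction rule: word_cong.induct) (use R in auto)

lemma equiv_word_cong: "equiv (lists I) (word_cong I R)"
proof (rule equivI)
  show "word_cong I R \<subseteq> lists I \<times> lists I"
    using word_cong_lists by auto
  show "refl_on (lists I) (word_cong I R)"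
    by (rule refl_onI) (rule word_cong.refl)
  show "sym (word_cong I R)"
    by (rule symI) (rule word_cong.sym)
  show "trans (word_cong I R)"
    by (rule transI) (rule word_cong.trans)
qed

lemma word_cong_append_right:
  "(u, v) \<in> word_cong I R \<Longrightarrow> w \<in> lists I \<Longrightarrow> (u @ w, v @ w) \<in> word_cong I R"
proof (induction rule: word_cong.induct)
  case (rel x y u v)
  then show ?case using word_cong.rel[of x y R u I "v @ w"] by auto
qed (simp add: word_cong.refl, blast intro: word_cong.sym, blast intro: word_cong.trans)

lemma word_cong_append_left:
  "(u, v) \<in> word_cong I R \<Longrightarrow> w \<in> lists I \<Longrightarrow> (w @ u, w @ v) \<in> word_cong I R"
proof (induction rule: word_cong.induct)
  case (rel x y u v)
  then show ?case using word_cong.rel[of x y R "w @ u" I v] by auto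
qed (simp add: word_cong.refl, blast intro: word_cong.sym, blast intro: word_cong.trans)

lemma word_cong_append:
  assumes "(u, u') \<in> word_cong I R" "(v, v') \<in> word_cong I R"
  shows "(u @ v, u' @ v') \<in> word_cong I R"
proof -
  have "v \<in> lists I" "u' \<in> lists I" using assms word_cong_lists by blast+
  then show ?thesis
    using assms word_cong_append_left word_cong_append_right word_cong.trans by metis
qed

lemma word_class_eq_iff:
  assumes "u \<in> lists I" "v \<in> lists I"
  shows "word_class I R u = word_class I R v \<longleftrightarrow> (u, v) \<in> word_cong I R"
  unfolding word_class_def using eq_equiv_class_iff[OF equiv_word_cong] assms by blast

lemma carrier_presented_monoid:
  "carrier (presented_monoid I R) = word_class I R ` lists I"
  by (auto simp: presented_monoid_def word_class_def quotient_def)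

lemma mult_presented_monoid:
  assumes u: "u \<in> lists I" and v: "v \<in> lists I"
  shows "word_class I R u \<otimes>\<^bsub>presented_monoid I R\<^esub> word_class I R v = word_class I R (u @ v)"
proof -
  have "word_class I R (u' @ v') = word_class I R (u @ v)"
    if "u' \<in> word_class I R u" "v' \<in> word_class I R v" for u' v'
  proof -
    have "(u, u') \<in> word_cong I R" "(v, v') \<in> word_cong I R"
      using that by (auto simp: word_class_def)
    then have "(u @ v, u' @ v') \<in> word_cong I R"
      by (rule word_cong_append)
    then show ?thesis
      using word_class_eq_iff word_cong_lists by metis
  qed
  moreover have "u \<in> word_class I R u" "v \<in> word_class I R v"
    unfolding word_class_def using u v by (simp_all add: word_cong.refl)
  ultimately have "(\<Union>u'\<in>word_class I R u. \<Union>v'\<in>word_class I R v. word_class I R (u' @ v'))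
      = word_class I R (u @ v)"
    by blast
  then show ?thesis
    by (simp add: presented_monoid_def)
qed

lemma one_presented_monoid: "\<one>\<^bsub>presented_monoid I R\<^esub> = word_class I R []"
  by (simp add: presented_monoid_def)

lemma monoid_presented_monoid: "monoid (presented_monoid I R)"
proof (rule monoidI)
  let ?G = "presented_monoid I R"
  note [simp] = carrier_presented_monoid one_presented_monoid mult_presented_monoid
  show "\<one>\<^bsub>?G\<^esub> \<in> carrier ?G"
    by simp
  fix X assume "X \<in> carrier ?G"
  then obtain x where x: "x \<in> lists I" "X = word_class I R x" by auto
  then show "\<one>\<^bsub>?G\<^esub> \<otimes>\<^bsub>?G\<^esub> X = X" "X \<otimes>\<^bsub>?G\<^esub> \<one>\<^bsub>?G\<^esub> = X"
    using mult_presented_monoid[of "[]" x] mult_presented_monoid[of x "[]"] by auto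
  fix Y assume "Y \<in> carrier ?G"
  then obtain y where y: "y \<in> lists I" "Y = word_class I R y" by auto
  have xy: "x @ y \<in> lists I" using x y by simp
  have XY: "X \<otimes>\<^bsub>?G\<^esub> Y = word_class I R (x @ y)"
    using mult_presented_monoid x y by simp
  then show "X \<otimes>\<^bsub>?G\<^esub> Y \<in> carrier ?G"
    using xy by (metis carrier_presented_monoid imageI)
  fix Z assume "Z \<in> carrier ?G"
  then obtain z where z: "z \<in> lists I" "Z = word_class I R z" by auto
  have yz: "y @ z \<in> lists I" using y z by simp
  show "X \<otimes>\<^bsub>?G\<^esub> Y \<otimes>\<^bsub>?G\<^esub> Z = X \<otimes>\<^bsub>?G\<^esub> (Y \<otimes>\<^bsub>?G\<^esub> Z)"
    using mult_presented_monoid[OF xy z(1)] mult_presented_monoid[OF x(1) yz]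
      mult_presented_monoid[OF y(1) z(1)] XY x y z by (metis append_assoc)
qed

end

definition monoid_hom :: "('a, 'c) monoid_scheme \<Rightarrow> ('b, 'd) monoid_scheme \<Rightarrow> ('a \<Rightarrow> 'b) \<Rightarrow> bool" where
  "monoid_hom G H \<phi> \<longleftrightarrow> \<phi> \<in> hom G H \<and> \<phi> \<one>\<^bsub>G\<^esub> = \<one>\<^bsub>H\<^esub>"


section \<open>Artin monoids and Coxeter groups\<close>

definition coxeter_matrix :: "'a set \<Rightarrow> ('a \<Rightarrow> 'a \<Rightarrow> enat) \<Rightarrow> bool" where
  "coxeter_matrix I m \<longleftrightarrow> finite I \<and> (\<forall>i\<in>I. m i i = 1) \<and>
    (\<forall>i\<in>I. \<forall>j\<in>I. m i j = m j i \<and> (i \<noteq> j \<longrightarrow> 2 \<le> m i j))"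

text \<open>The word \<open>iji\<dots>\<close> with \<open>n\<close> letters.\<close>

fun alternating :: "'a \<Rightarrow> 'a \<Rightarrow> nat \<Rightarrow> 'a list" where
  "alternating i j 0 = []"
| "alternating i j (Suc n) = i # alternating j i n"

definition artin_relations :: "'a set \<Rightarrow> ('a \<Rightarrow> 'a \<Rightarrow> enat) \<Rightarrow> ('a list \<times> 'a list) set" where
  "artin_relations I m =
    {(alternating i j n, alternating j i n) | i j n. i \<in> I \<and> j \<in> I \<and> i \<noteq> j \<and> m i j = enat n}"

abbreviation artin_monoid :: "'a set \<Rightarrow> ('a \<Rightarrow> 'a \<Rightarrow> enat) \<Rightarrow> 'a list set monoid" where
  "artin_monoid I m \<equiv> presented_monoid I (artin_relations I m)"

text \<open>The element \<open>T\<^sub>i T\<^sub>j \<dots>\<close> of the Artin monoid for the word \<open>[i, j, \<dots>]\<close>.\<close>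

abbreviation artin_elt :: "'a set \<Rightarrow> ('a \<Rightarrow> 'a \<Rightarrow> enat) \<Rightarrow> 'a list \<Rightarrow> 'a list set" where
  "artin_elt I m \<equiv> word_class I (artin_relations I m)"

text \<open>The relations \<open>(s\<^sub>i s\<^sub>j)^m\<^sub>i\<^sub>j = 1\<close>, including \<open>i = j\<close>; since they make the
  generators involutions, the monoid they present is the Coxeter group.\<close>

definition coxeter_relations :: "'a set \<Rightarrow> ('a \<Rightarrow> 'a \<Rightarrow> enat) \<Rightarrow> ('a list \<times> 'a list) set" where
  "coxeter_relations I m =
    {(concat (replicate n [i, j]), []) | i j n. i \<in> I \<and> j \<in> I \<and> m i j = enat n}"

abbreviation coxeter_group :: "'a set \<Rightarrow> ('a \<Rightarrow> 'a \<Rightarrow> enat) \<Rightarrow> 'a list set monoid" where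
  "coxeter_group I m \<equiv> presented_monoid I (coxeter_relations I m)"

abbreviation coxeter_elt :: "'a set \<Rightarrow> ('a \<Rightarrow> 'a \<Rightarrow> enat) \<Rightarrow> 'a list \<Rightarrow> 'a list set" where
  "coxeter_elt I m \<equiv> word_class I (coxeter_relations I m)"

lemma alternating_in_lists: "i \<in> I \<Longrightarrow> j \<in> I \<Longrightarrow> alternating i j n \<in> lists I"
  by (induction n arbitrary: i j) auto

lemma artin_relations_lists: "artin_relations I m \<subseteq> lists I \<times> lists I"
  by (clarsimp simp: artin_relations_def simp del: in_lists_conv_set)
    (simp add: alternating_in_lists del: in_lists_conv_set)

lemma coxeter_relations_lists: "coxeter_relations I m \<subseteq> lists I \<times> lists I"
  unfolding coxeter_relations_def by (auto split: if_splits)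

lemma monoid_artin_monoid: "monoid (artin_monoid I m)"
  by (rule monoid_presented_monoid[OF artin_relations_lists])

lemma coxeter_cong_rev_append:
  assumes "\<forall>i\<in>I. m i i = 1" "w \<in> lists I"
  shows "(rev w @ w, []) \<in> word_cong I (coxeter_relations I m)"
  using assms(2)
proof (induction w)
  case Nil
  then show ?case by (simp add: word_cong.refl)
next
  case (Cons i w)
  have "([i, i], []) \<in> coxeter_relations I m"
    unfolding coxeter_relations_def using assms(1) Cons.hyps one_enat_def
    by (auto intro!: exI[of _ i] exI[of _ "1::nat"])
  moreover have "rev w \<in> lists I"
    using Cons.hyps by (simp add: in_lists_conv_set)
  ultimately have "(rev w @ [i, i] @ w, rev w @ [] @ w) \<in> word_cong I (coxeter_relations I m)"
    using Cons.hyps by (intro word_cong.rel)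
  then have "(rev (i # w) @ (i # w), rev w @ w) \<in> word_cong I (coxeter_relations I m)"
    by simp
  then show ?case using Cons.IH by (rule word_cong.trans)
qed

lemma group_coxeter_group:
  assumes "coxeter_matrix I m"
  shows "group (coxeter_group I m)"
proof -
  note R = coxeter_relations_lists[of I m]
  interpret monoid "coxeter_group I m"
    by (rule monoid_presented_monoid[OF R])
  show ?thesis
  proof (rule group_l_invI)
    fix X assume "X \<in> carrier (coxeter_group I m)"
    then obtain w where w: "w \<in> lists I" "X = coxeter_elt I m w"
      by (auto simp: carrier_presented_monoid[OF R])
    then have r: "rev w \<in> lists I" by (auto simp: in_lists_conv_set)
    have "coxeter_elt I m (rev w) \<otimes>\<^bsub>coxeter_group I m\<^esub> X = \<one>\<^bsub>coxeter_group I m\<^esub>"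
      using coxeter_cong_rev_append[of I m w] assms w r
      by (simp add: mult_presented_monoid[OF R] one_presented_monoid[OF R]
          word_class_eq_iff[OF R] coxeter_matrix_def)
    then show "\<exists>Y\<in>carrier (coxeter_group I m). Y \<otimes>\<^bsub>coxeter_group I m\<^esub> X = \<one>\<^bsub>coxeter_group I m\<^esub>"
      using r by (auto simp: carrier_presented_monoid[OF R])
  qed
qed

text \<open>Elements of the Coxeter group are sets of words, so \<open>u \<in> w\<close> says that the word \<open>u\<close>
  represents \<open>w\<close>.\<close>

definition coxeter_length :: "'a list set \<Rightarrow> nat" where
  "coxeter_length w = (LEAST n. \<exists>u\<in>w. length u = n)"

definition reduced_expression :: "'a list \<Rightarrow> 'a list set \<Rightarrow> bool" where
  "reduced_expression u w \<longleftrightarrow> u \<in> w \<and> length u = coxeter_length w"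

definition parabolic :: "'a set \<Rightarrow> ('a \<Rightarrow> 'a \<Rightarrow> enat) \<Rightarrow> 'a set \<Rightarrow> 'a list set set" where
  "parabolic I m J = generate (coxeter_group I m) ((\<lambda>j. coxeter_elt I m [j]) ` J)"

definition finite_type :: "'a set \<Rightarrow> ('a \<Rightarrow> 'a \<Rightarrow> enat) \<Rightarrow> 'a set \<Rightarrow> bool" where
  "finite_type I m J \<longleftrightarrow> J \<subseteq> I \<and> finite (parabolic I m J)"

text \<open>For \<open>J\<close> of finite type such an element exists and is unique.\<close>

definition is_longest_element ::
    "'a set \<Rightarrow> ('a \<Rightarrow> 'a \<Rightarrow> enat) \<Rightarrow> 'a set \<Rightarrow> 'a list set \<Rightarrow> bool" where
  "is_longest_element I m J w \<longleftrightarrow> is_arg_max coxeter_length (\<lambda>w. w \<in> parabolic I m J) w"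

text \<open>\<open>X = T\<^sub>w\<close>, where \<open>T\<^sub>w = T\<^sub>i T\<^sub>j \<dots>\<close> for a reduced expression
  \<open>s\<^sub>i s\<^sub>j \<dots>\<close> of \<open>w\<close>. By Matsumoto's theorem \<open>T\<^sub>w\<close> does not depend on the reduced
  expression.\<close>

definition is_artin_lift ::
    "'a set \<Rightarrow> ('a \<Rightarrow> 'a \<Rightarrow> enat) \<Rightarrow> 'a list set \<Rightarrow> 'a list set \<Rightarrow> bool" where
  "is_artin_lift I m w X \<longleftrightarrow> (\<exists>u. reduced_expression u w \<and> X = artin_elt I m u)"


section \<open>Standard homomorphisms and their compositions\<close>

definition standard_hom ::
    "'a set \<Rightarrow> ('a \<Rightarrow> 'a \<Rightarrow> enat) \<Rightarrow> 'b set \<Rightarrow> ('b \<Rightarrow> 'b \<Rightarrow> enat) \<Rightarrow>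
      ('a list set \<Rightarrow> 'b list set) \<Rightarrow> bool" where
  "standard_hom I m I' m' \<phi> \<longleftrightarrow>
    coxeter_matrix I m \<and> coxeter_matrix I' m' \<and>
    monoid_hom (artin_monoid I m) (artin_monoid I' m') \<phi> \<and>
    (\<forall>i\<in>I. \<exists>J w. finite_type I' m' J \<and> is_longest_element I' m' J w \<and>
      is_artin_lift I' m' w (\<phi> (artin_elt I m [i])))"

text \<open>Compositions of one or more standard homomorphisms between Coxeter matrices over arbitrary
  index types. The matrices at the intermediate stages are indexed by finite sets of natural
  numbers, which is no restriction: every finite set is in bijection with one, and the relabelling
  isomorphisms of Artin monoids (in particular the identities) are standard.\<close>

inductive standard_chain ::
    "'a set \<Rightarrow> ('a \<Rightarrow> 'a \<Rightarrow> enat) \<Rightarrow> nat set \<Rightarrow> (nat \<Rightarrow> nat \<Rightarrow> enat) \<Rightarrow>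
      ('a list set \<Rightarrow> nat list set) \<Rightarrow> bool"
  for I m where
  single: "standard_hom I m K n \<phi> \<Longrightarrow> standard_chain I m K n \<phi>"
| extend: "standard_chain I m K n \<phi> \<Longrightarrow> standard_hom K n L p \<psi> \<Longrightarrow>
    standard_chain I m L p (\<psi> \<circ> \<phi>)"

definition Ast_morphism ::
    "'a set \<Rightarrow> ('a \<Rightarrow> 'a \<Rightarrow> enat) \<Rightarrow> 'b set \<Rightarrow> ('b \<Rightarrow> 'b \<Rightarrow> enat) \<Rightarrow>
      ('a list set \<Rightarrow> 'b list set) \<Rightarrow> bool" where
  "Ast_morphism I m I' m' \<Phi> \<longleftrightarrow>
    standard_hom I m I' m' \<Phi> \<or>
    (\<exists>K n \<chi> \<psi>. standard_chain I m K n \<chi> \<and> standard_hom K n I' m' \<psi> \<and>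
      (\<forall>X\<in>carrier (artin_monoid I m). \<Phi> X = \<psi> (\<chi> X)))"


section \<open>Tits homomorphisms\<close>

definition tits_matrix :: "('a \<Rightarrow> 'a \<Rightarrow> enat) \<Rightarrow> ('a \<Rightarrow> nat) \<Rightarrow> 'a \<Rightarrow> 'a \<Rightarrow> enat" where
  "tits_matrix m d i j =
    (if m i j \<le> 2 \<or> d i * d j = 1 then m i j
     else if m i j = 3 \<and> d i * d j \<in> {2, 3} then enat (2 * d i * d j)
     else \<infinity>)"

definition tits_hom ::
    "'a set \<Rightarrow> ('a \<Rightarrow> 'a \<Rightarrow> enat) \<Rightarrow> ('a \<Rightarrow> nat) \<Rightarrow> ('a list set \<Rightarrow> 'a list set) \<Rightarrow> bool" where
  "tits_hom I m d \<Phi> \<longleftrightarrow>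
    monoid_hom (artin_monoid I (tits_matrix m d)) (artin_monoid I m) \<Phi> \<and>
    (\<forall>i\<in>I. \<Phi> (artin_elt I (tits_matrix m d) [i]) = artin_elt I m [i] [^]\<^bsub>artin_monoid I m\<^esub> d i)"

end

theory Submission
  imports Defs Complex_Main
begin

text \<open>The homomorphism factors through an intermediate Coxeter matrix in which every \<open>i\<close> is replaced
  by \<open>d i\<close> pairwise commuting copies and the label between copies of \<open>i \<noteq> j\<close> is \<open>m i j\<close>. The first
  factor sends a generator to the product of its copies, the longest element of type \<open>A\<^sub>1^d\<close>. It is
  well defined because the bipartite halves of \<open>A\<^sub>3\<close> and \<open>D\<^sub>4\<close> satisfy the braid relations of length
  \<open>4\<close> and \<open>6\<close>. The second factor sends all copies of \<open>i\<close> to \<open>T\<^sub>i\<close>.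

  That a product of distinct commuting generators is reduced is seen in the contragredient of the
  reflection representation: \<open>s\<^sub>i\<close> fixes every function vanishing at \<open>i\<close>, so a word without the
  letter \<open>x\<close> fixes the indicator function of the complement of its letters, whereas the product
  changes its sign at \<open>x\<close>.\<close>

section \<open>Words and homomorphisms of presented monoids\<close>

context
  fixes I :: "'a set" and R :: "('a list \<times> 'a list) set"
  assumes R: "R \<subseteq> lists I \<times> lists I"
begin

lemma word_cong_context:
  assumes "(x, y) \<in> word_cong I R" "u \<in> lists I" "v \<in> lists I"
  shows "(u @ x @ v, u @ y @ v) \<in> word_cong I R"
  using assms by (intro word_cong_append_left[OF R] word_cong_append_right[OF R])

lemma word_cong_relation: "(x, y) \<in> R \<Longrightarrow> (x, y) \<in> word_cong I R"
  using word_cong.rel[of x y R "[]" I "[]"] by simp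

lemma word_cong_commute_letter:
  assumes "x \<in> I" "v \<in> lists I" "\<forall>y\<in>set v. ([x, y], [y, x]) \<in> word_cong I R"
  shows "(x # v, v @ [x]) \<in> word_cong I R"
  using assms(2,3)
proof (induction v)
  case Nil
  then show ?case using assms(1) by (simp add: word_cong.refl)
next
  case (Cons y v)
  have "([x, y] @ v, [y, x] @ v) \<in> word_cong I R"
    using Cons by (intro word_cong_append_right[OF R]) auto
  moreover have "([y] @ (x # v), [y] @ (v @ [x])) \<in> word_cong I R"
    using Cons by (intro word_cong_append_left[OF R]) auto
  ultimately show ?case
    using word_cong.trans by fastforce
qed

lemma word_cong_commute:
  assumes "u \<in> lists I" "v \<in> lists I"
    and "\<forall>x\<in>set u. \<forall>y\<in>set v. ([x, y], [y, x]) \<in> word_cong I R"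
  shows "(u @ v, v @ u) \<in> word_cong I R"
  using assms(1,3)
proof (induction u)
  case Nil
  then show ?case using assms(2) by (simp add: word_cong.refl)
next
  case (Cons x u)
  have "([x] @ (u @ v), [x] @ (v @ u)) \<in> word_cong I R"
    using Cons by (intro word_cong_append_left[OF R]) auto
  moreover have "((x # v) @ u, (v @ [x]) @ u) \<in> word_cong I R"
    using Cons assms(2) by (intro word_cong_append_right[OF R] word_cong_commute_letter) auto
  ultimately show ?case
    using word_cong.trans by fastforce
qed

lemma word_class_pow:
  assumes "i \<in> I"
  shows "word_class I R [i] [^]\<^bsub>presented_monoid I R\<^esub> n = word_class I R (replicate n i)"
proof -
  interpret monoid "presented_monoid I R"
    by (rule monoid_presented_monoid[OF R])
  show ?thesis
  proof (induction n)
    case 0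
    then show ?case by (simp add: one_presented_monoid[OF R])
  next
    case (Suc n)
    have "replicate n i \<in> lists I" using assms by auto
    then show ?case
      using Suc assms by (simp add: mult_presented_monoid[OF R] flip: replicate_append_same)
  qed
qed

text \<open>Every element is a finite product of generators, so induction on a representing word
  applies; the empty word is where preservation of the unit enters.\<close>

lemma monoid_hom_presented_eqI:
  assumes \<phi>: "monoid_hom (presented_monoid I R) G \<phi>" and \<psi>: "monoid_hom (presented_monoid I R) G \<psi>"
    and gen: "\<And>i. i \<in> I \<Longrightarrow> \<phi> (word_class I R [i]) = \<psi> (word_class I R [i])"
    and X: "X \<in> carrier (presented_monoid I R)"
  shows "\<phi> X = \<psi> X"
proof -
  have "\<phi> (word_class I R u) = \<psi> (word_class I R u)" if "u \<in> lists I" for u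
    using that
  proof (induction u)
    case Nil
    then show ?case
      using \<phi> \<psi> by (simp add: monoid_hom_def one_presented_monoid[OF R])
  next
    case (Cons i u)
    have eq: "word_class I R (i # u) = word_class I R [i] \<otimes>\<^bsub>presented_monoid I R\<^esub> word_class I R u"
      using Cons mult_presented_monoid[OF R, of "[i]" u] by simp
    have "word_class I R [i] \<in> carrier (presented_monoid I R)"
      "word_class I R u \<in> carrier (presented_monoid I R)"
      using Cons by (auto simp: carrier_presented_monoid[OF R])
    then have *: "\<chi> (word_class I R (i # u)) = \<chi> (word_class I R [i]) \<otimes>\<^bsub>G\<^esub> \<chi> (word_class I R u)"
      if "monoid_hom (presented_monoid I R) G \<chi>" for \<chi>
      using that eq hom_mult unfolding monoid_hom_def by metis
    show ?case
      using *[OF \<phi>] *[OF \<psi>] Cons gen by simp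
  qed
  then show ?thesis
    using X by (auto simp: carrier_presented_monoid[OF R])
qed

end

lemma monoid_hom_comp: "monoid_hom G H \<phi> \<Longrightarrow> monoid_hom H K \<psi> \<Longrightarrow> monoid_hom G K (\<psi> \<circ> \<phi>)"
  by (auto simp: monoid_hom_def intro: hom_compose)

section \<open>Homomorphisms given by substituting words for generators\<close>

text \<open>The union runs over all representing words, so no representative is chosen. Once
  \<open>f\<close> respects the relations, all classes in the union coincide and it is a single
  class.\<close>

definition word_subst_hom ::
    "'b set \<Rightarrow> ('b list \<times> 'b list) set \<Rightarrow> ('a \<Rightarrow> 'b list) \<Rightarrow> 'a list set \<Rightarrow> 'b list set" where
  "word_subst_hom I' R' f X = (\<Union>u\<in>X. word_class I' R' (concat (map f u)))"

context
  fixes I :: "'a set" and R :: "('a list \<times> 'a list) set"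
    and I' :: "'b set" and R' :: "('b list \<times> 'b list) set" and f :: "'a \<Rightarrow> 'b list"
  assumes R: "R \<subseteq> lists I \<times> lists I" and R': "R' \<subseteq> lists I' \<times> lists I'"
    and f: "\<And>i. i \<in> I \<Longrightarrow> f i \<in> lists I'"
    and rels: "\<And>x y. (x, y) \<in> R \<Longrightarrow> (concat (map f x), concat (map f y)) \<in> word_cong I' R'"
begin

lemma word_subst_lists: "u \<in> lists I \<Longrightarrow> concat (map f u) \<in> lists I'"
  using f by fastforce

lemma word_subst_cong:
  "(u, v) \<in> word_cong I R \<Longrightarrow> (concat (map f u), concat (map f v)) \<in> word_cong I' R'"
proof (induction rule: word_cong.induct)
  case (refl w)
  then show ?case by (simp only: word_cong.refl word_subst_lists)
next
  case (rel x y u v)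
  then show ?case
    using word_cong_context[OF R' rels] word_subst_lists by simp
qed (blast intro: word_cong.sym word_cong.trans)+

lemma word_subst_hom_word_class:
  assumes "u \<in> lists I"
  shows "word_subst_hom I' R' f (word_class I R u) = word_class I' R' (concat (map f u))"
proof -
  have "word_class I' R' (concat (map f v)) = word_class I' R' (concat (map f u))"
    if "v \<in> word_class I R u" for v
  proof -
    have "(u, v) \<in> word_cong I R" using that by (simp add: word_class_def)
    then show ?thesis
      using word_subst_cong word_class_eq_iff[OF R'] word_cong_lists[OF R'] by metis
  qed
  moreover have "u \<in> word_class I R u"
    using assms by (simp add: word_class_def word_cong.refl)
  ultimately show ?thesis
    unfolding word_subst_hom_def by blast
qed

lemma monoid_hom_word_subst_hom:
  "monoid_hom (presented_monoid I R) (presented_monoid I' R') (word_subst_hom I' R' f)"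
proof -
  let ?\<phi> = "word_subst_hom I' R' f"
  have "?\<phi> (word_class I R u) \<in> carrier (presented_monoid I' R')" if "u \<in> lists I" for u
    using that word_subst_hom_word_class word_subst_lists
    by (simp only: carrier_presented_monoid[OF R'] imageI)
  moreover have "?\<phi> (word_class I R u \<otimes>\<^bsub>presented_monoid I R\<^esub> word_class I R v) =
      ?\<phi> (word_class I R u) \<otimes>\<^bsub>presented_monoid I' R'\<^esub> ?\<phi> (word_class I R v)"
    if "u \<in> lists I" "v \<in> lists I" for u v
    using that word_subst_lists word_subst_hom_word_class[of "u @ v"]
    by (simp only: mult_presented_monoid[OF R] mult_presented_monoid[OF R'] word_subst_hom_word_class
        map_append concat_append append_in_lists_conv simp_thms)
  moreover have "?\<phi> \<one>\<^bsub>presented_monoid I R\<^esub> = \<one>\<^bsub>presented_monoid I' R'\<^esub>"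
    using word_subst_hom_word_class[of "[]"]
    by (simp add: one_presented_monoid[OF R] one_presented_monoid[OF R'])
  ultimately show ?thesis
    by (auto simp: monoid_hom_def hom_def carrier_presented_monoid[OF R] simp del: in_lists_conv_set)
qed

end

section \<open>The reflection representation\<close>

text \<open>Only the defining relations have to hold, so the label \<open>\<infinity>\<close> may be given the entry \<open>0\<close> instead
  of the usual \<open>-2\<close>; the representation need not be faithful.\<close>

definition cartan :: "('a \<Rightarrow> 'a \<Rightarrow> enat) \<Rightarrow> 'a \<Rightarrow> 'a \<Rightarrow> real" where
  "cartan m i k = (if i = k then 2 else case m i k of enat n \<Rightarrow> - 2 * cos (pi / n) | \<infinity> \<Rightarrow> 0)"

text \<open>\<open>f\<close> holds the values of a linear form on the simple roots, and
  \<open>coxeter_refl m i f\<close> is this form composed with the reflection sending the root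
  \<open>k\<close> to itself minus \<open>cartan m i k\<close> times the root
  \<open>i\<close>.\<close>

definition coxeter_refl :: "('a \<Rightarrow> 'a \<Rightarrow> enat) \<Rightarrow> 'a \<Rightarrow> ('a \<Rightarrow> real) \<Rightarrow> 'a \<Rightarrow> real" where
  "coxeter_refl m i f = (\<lambda>k. f k - cartan m i k * f i)"

lemma coxeter_refl_involution: "coxeter_refl m i (coxeter_refl m i f) = f"
  by (simp add: coxeter_refl_def cartan_def fun_eq_iff)

lemma sin_three_term: "sin ((s + 2) * \<theta>) = 2 * cos \<theta> * sin ((s + 1) * \<theta>) - sin (s * \<theta>)" for s \<theta> :: real
proof -
  have "sin ((s + 1) * \<theta> + \<theta>) + sin ((s + 1) * \<theta> - \<theta>) = 2 * cos \<theta> * sin ((s + 1) * \<theta>)"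
    by (simp add: sin_add sin_diff)
  then show ?thesis by (simp add: algebra_simps)
qed

text \<open>Each reflection subtracts a multiple of a row of \<open>cartan\<close>. The successive
  multiples satisfy a three-term recurrence solved by sines of period \<open>2 * n\<close>, and over
  one period the multiples of row \<open>i\<close> and those of row \<open>j\<close> each sum to
  zero.\<close>

lemma coxeter_refl_order:
  fixes n :: nat
  assumes n: "n \<ge> 2" and ij: "i \<noteq> j" "m i j = enat n" "m j i = enat n"
  shows "((coxeter_refl m i \<circ> coxeter_refl m j) ^^ n) f = f"
proof -
  define \<theta> where "\<theta> = pi / n"
  have "0 < \<theta>" "\<theta> < pi" using n by (auto simp: \<theta>_def divide_less_eq)
  then have sin: "sin \<theta> > 0" by (rule sin_gt_zero)
  define c where "c = 2 * cos \<theta>"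
  have cij: "cartan m i j = - c" "cartan m j i = - c" "cartan m i i = 2" "cartan m j j = 2"
    using ij by (simp_all add: cartan_def c_def \<theta>_def)
  \<comment> \<open>For s >= 1, \<open>X s\<close> will be the value of the current form at the root
    of the s-th reflection applied, the first being \<open>j\<close>. The difference
    \<open>s - 1\<close> is taken in the reals, so that \<open>X 0 = - f i\<close>.\<close>
  define X :: "nat \<Rightarrow> real"
    where "X s = (f j * sin (s * \<theta>) + f i * sin ((s - 1) * \<theta>)) / sin \<theta>" for s
  have rec: "X (s + 2) = c * X (s + 1) - X s" for s
  proof -
    have "sin (real (s + 2) * \<theta>) = c * sin (real (s + 1) * \<theta>) - sin (real s * \<theta>)"
      "sin ((real (s + 2) - 1) * \<theta>) = c * sin ((real (s + 1) - 1) * \<theta>) - sin ((real s - 1) * \<theta>)"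
      using sin_three_term[of s \<theta>] sin_three_term[of "real s - 1" \<theta>]
      by (simp_all add: c_def algebra_simps)
    then have "X (s + 2) = (f j * (c * sin (real (s + 1) * \<theta>) - sin (real s * \<theta>)) +
        f i * (c * sin ((real (s + 1) - 1) * \<theta>) - sin ((real s - 1) * \<theta>))) / sin \<theta>"
      by (simp only: X_def)
    also have "\<dots> = c * X (s + 1) - X s"
      by (simp add: X_def add_divide_distrib diff_divide_distrib algebra_simps)
    finally show ?thesis .
  qed
  have X0: "X 0 = - f i" "X 1 = f j" using sin by (simp_all add: X_def)
  have per: "X (2 * n + s) = X s" for s
  proof -
    have "(2 * n + s) * \<theta> = s * \<theta> + 2 * pi" "((2 * n + s) - 1) * \<theta> = (s - 1) * \<theta> + 2 * pi"
      for s :: real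
      using n by (simp_all add: \<theta>_def field_simps)
    then show ?thesis by (simp add: X_def)
  qed
  \<comment> \<open>Sums over a full period do not change when the index is shifted by two. Summing
    the recurrence therefore gives two linear equations in \<open>S0\<close> and \<open>S1\<close>,
    whose determinant \<open>4 - c\<^sup>2\<close> is four times the square of
    \<open>sin \<theta>\<close>.\<close>
  define S0 where "S0 = (\<Sum>s<n. X (2 * s))"
  define S1 where "S1 = (\<Sum>s<n. X (2 * s + 1))"
  have shift: "(\<Sum>s<n. g (Suc s)) = (\<Sum>s<n. g s)" if "g n = g 0" for g :: "nat \<Rightarrow> real"
    using sum.lessThan_Suc_shift[of g n] that by simp
  have S0': "(\<Sum>s<n. X (2 * s + 2)) = S0"
    using shift[of "\<lambda>s. X (2 * s)"] per[of 0] by (simp add: S0_def)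
  have S1': "(\<Sum>s<n. X (2 * s + 3)) = S1"
    using shift[of "\<lambda>s. X (2 * s + 1)"] per[of 1] by (simp add: S1_def numeral_3_eq_3)
  have "(\<Sum>s<n. X (2 * s + 2)) = c * S1 - S0"
    unfolding rec S0_def S1_def by (simp add: sum_subtractf sum_distrib_left)
  then have e1: "2 * S0 = c * S1" using S0' by simp
  have "X (2 * s + 3) = c * X (2 * s + 2) - X (2 * s + 1)" for s
    using rec[of "2 * s + 1"] by (simp add: numeral_3_eq_3)
  then have "(\<Sum>s<n. X (2 * s + 3)) = c * (\<Sum>s<n. X (2 * s + 2)) - S1"
    by (simp add: S1_def sum_subtractf sum_distrib_left)
  then have e2: "2 * S1 = c * S0" using S0' S1' by simp
  have "4 - c\<^sup>2 = 4 * (sin \<theta>)\<^sup>2"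
    by (simp add: c_def power_mult_distrib cos_squared_eq)
  then have c: "4 - c\<^sup>2 \<noteq> 0" using sin by simp
  have "(4 - c\<^sup>2) * S0 = 0" "(4 - c\<^sup>2) * S1 = 0"
    using e1 e2 by algebra+
  with c have S: "S0 = 0" "S1 = 0" by auto
  \<comment> \<open>The value at an arbitrary \<open>k\<close> is driven by the values at
    \<open>i\<close> and \<open>j\<close>, so the three are tracked together. At
    \<open>t = n\<close> both sums vanish.\<close>
  have "((coxeter_refl m i \<circ> coxeter_refl m j) ^^ t) f k =
      f k - cartan m j k * (\<Sum>s<t. X (2 * s + 1)) - cartan m i k * (\<Sum>s<t. X (2 * s + 2)) \<and>
    ((coxeter_refl m i \<circ> coxeter_refl m j) ^^ t) f i = - X (2 * t) \<and>
    ((coxeter_refl m i \<circ> coxeter_refl m j) ^^ t) f j = X (2 * t + 1)" for t k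
  proof (induction t)
    case 0
    then show ?case using X0 by simp
  next
    case (Suc t)
    have r: "X (2 * t + 2) = c * X (2 * t + 1) - X (2 * t)"
      "X (2 * t + 3) = c * X (2 * t + 2) - X (2 * t + 1)"
      using rec[of "2 * t"] rec[of "2 * t + 1"] by (simp_all add: numeral_3_eq_3)
    define g where "g = ((coxeter_refl m i \<circ> coxeter_refl m j) ^^ t) f"
    have "coxeter_refl m i (coxeter_refl m j g) l =
        g l - cartan m j l * g j - cartan m i l * (g i + c * g j)" for l
      by (simp add: coxeter_refl_def cij)
    moreover have g: "g k = f k - cartan m j k * (\<Sum>s<t. X (2 * s + 1)) - cartan m i k * (\<Sum>s<t. X (2 * s + 2))"
      "g i = - X (2 * t)" "g j = X (2 * t + 1)"
      using Suc unfolding g_def by blast+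
    moreover have "g i + c * g j = X (2 * t + 2)"
      using g r by simp
    ultimately have step: "coxeter_refl m i (coxeter_refl m j g) l =
        g l - cartan m j l * X (2 * t + 1) - cartan m i l * X (2 * t + 2)" for l
      by simp
    have h: "((coxeter_refl m i \<circ> coxeter_refl m j) ^^ Suc t) f = coxeter_refl m i (coxeter_refl m j g)"
      by (simp only: g_def funpow.simps comp_apply)
    show ?case
      unfolding h using step[of i] step[of j] step[of k] g r
      by (simp add: cij algebra_simps eval_nat_numeral)
  qed
  from this[of n] show ?thesis
    using S S0' by (auto simp: fun_eq_iff S1_def)
qed

lemma foldr_concat_replicate:
  "foldr g (concat (replicate n [i, j])) = (g i \<circ> g j) ^^ n"
  by (induction n) auto

lemma coxeter_refl_cong:
  assumes "coxeter_matrix I m"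
  shows "(u, v) \<in> word_cong I (coxeter_relations I m) \<Longrightarrow>
    foldr (coxeter_refl m) u = foldr (coxeter_refl m) v"
proof (induction rule: word_cong.induct)
  case (rel x y u v)
  then obtain i j n where ij: "x = concat (replicate n [i, j])" "y = []" "i \<in> I" "j \<in> I" "m i j = enat n"
    by (auto simp: coxeter_relations_def)
  have "foldr (coxeter_refl m) x = id"
  proof (cases "i = j")
    case True
    then have "n = 1" using ij assms by (auto simp: coxeter_matrix_def one_enat_def)
    then show ?thesis
      using True ij by (simp add: fun_eq_iff coxeter_refl_involution)
  next
    case False
    have "2 \<le> m i j" "m j i = m i j"
      using False ij(3,4) assms unfolding coxeter_matrix_def by blast+
    then have "n \<ge> 2" "m j i = enat n"
      using ij by (simp_all add: numeral_eq_enat)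
    then show ?thesis
      using False ij coxeter_refl_order[of n i j m]
      by (simp add: foldr_concat_replicate fun_eq_iff)
  qed
  then show ?case using ij by simp
qed auto

section \<open>Longest elements generated by commuting reflections\<close>

lemma coxeter_refl_fixes: "\<forall>x\<in>set u. f x = 0 \<Longrightarrow> foldr (coxeter_refl m) u f = f"
  by (induction u) (auto simp: coxeter_refl_def fun_eq_iff)

text \<open>A reflection at one letter leaves the values at the other letters unchanged, because
  \<open>cartan\<close> vanishes between distinct commuting letters; each correction is therefore
  computed from the original \<open>f\<close>.\<close>

lemma coxeter_refl_commuting:
  assumes "distinct u" "\<forall>x\<in>set u. \<forall>y\<in>set u. x \<noteq> y \<longrightarrow> m x y = 2"
  shows "foldr (coxeter_refl m) u f k = f k - (\<Sum>x\<in>set u. cartan m x k * f x)"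
  using assms
proof (induction u arbitrary: k)
  case (Cons y u)
  have "cartan m x y = 0" if "x \<in> set u" for x
    using Cons.prems that by (auto simp: cartan_def numeral_eq_enat)
  then show ?case
    using Cons by (simp add: coxeter_refl_def)
qed simp

lemma commuting_word_letters:
  assumes "coxeter_matrix I m" "(u, v) \<in> word_cong I (coxeter_relations I m)"
    and "distinct u" "\<forall>x\<in>set u. \<forall>y\<in>set u. x \<noteq> y \<longrightarrow> m x y = 2"
  shows "set u \<subseteq> set v"
proof
  fix z assume z: "z \<in> set u"
  \<comment> \<open>\<open>f\<close> vanishes on the letters of \<open>v\<close>, so
    \<open>v\<close> fixes it, while \<open>u\<close> turns \<open>f z\<close> into
    \<open>f z - 2 * f z\<close>. Since both words act alike, \<open>f z = 0\<close>, which puts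
    \<open>z\<close> in \<open>set v\<close>.\<close>
  define f :: "'a \<Rightarrow> real" where "f = (\<lambda>x. if x \<in> set v then 0 else 1)"
  have "foldr (coxeter_refl m) u f z = f z"
    using coxeter_refl_cong[OF assms(1,2)] coxeter_refl_fixes[of v f] by (simp add: f_def)
  moreover have "(\<Sum>x\<in>set u. cartan m x z * f x) = (\<Sum>x\<in>{z}. cartan m x z * f x)"
    using assms(4) z by (intro sum.mono_neutral_right) (auto simp: cartan_def numeral_eq_enat)
  ultimately have "f z = 0"
    using coxeter_refl_commuting[OF assms(3,4), of f z] by (simp add: cartan_def)
  then show "z \<in> set v" by (auto simp: f_def split: if_splits)
qed

lemma coxeter_length_le: "u \<in> lists I \<Longrightarrow> coxeter_length (coxeter_elt I m u) \<le> length u"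
  unfolding coxeter_length_def
  by (rule Least_le) (auto simp: word_class_def intro: word_cong.refl)

text \<open>A word for the same element contains every letter of \<open>u\<close>, hence is at least
  as long because \<open>u\<close> repeats none.\<close>

lemma reduced_commuting:
  assumes "coxeter_matrix I m" "u \<in> lists I"
    and "distinct u" "\<forall>x\<in>set u. \<forall>y\<in>set u. x \<noteq> y \<longrightarrow> m x y = 2"
  shows "reduced_expression u (coxeter_elt I m u)"
proof -
  have u: "u \<in> coxeter_elt I m u"
    using assms(2) by (simp add: word_class_def word_cong.refl)
  have "length u \<le> length v" if "v \<in> coxeter_elt I m u" for v
  proof -
    have "set u \<subseteq> set v"
      using commuting_word_letters[OF assms(1) _ assms(3,4)] that by (simp add: word_class_def)
    then show ?thesis
      using assms(3) card_mono[of "set v" "set u"] card_length[of v]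
      by (simp add: distinct_card)
  qed
  then have "coxeter_length (coxeter_elt I m u) = length u"
    unfolding coxeter_length_def using u by (intro Least_equality) auto
  with u show ?thesis by (simp add: reduced_expression_def)
qed

section \<open>Parabolic subgroups generated by commuting reflections\<close>

lemma coxeter_cong_square:
  assumes "coxeter_matrix I m" "i \<in> I"
  shows "([i, i], []) \<in> word_cong I (coxeter_relations I m)"
  using coxeter_cong_rev_append[of I m "[i]"] assms by (simp add: coxeter_matrix_def)

lemma coxeter_cong_commute:
  assumes "coxeter_matrix I m" "i \<in> I" "j \<in> I" "i \<noteq> j \<longrightarrow> m i j = 2"
  shows "([i, j], [j, i]) \<in> word_cong I (coxeter_relations I m)"
proof (cases "i = j")
  case True
  then show ?thesis using assms by (simp add: word_cong.refl)
next
  case False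
  note R = coxeter_relations_lists[of I m] and [trans] = word_cong.trans
  note square = coxeter_cong_square[OF assms(1)]
  have "m j i = enat 2" using assms False by (auto simp: coxeter_matrix_def numeral_eq_enat)
  then have "(concat (replicate 2 [j, i]), []) \<in> coxeter_relations I m"
    using assms by (auto simp: coxeter_relations_def)
  then have "([j, i, j, i], []) \<in> word_cong I (coxeter_relations I m)"
    using word_cong_relation[OF R] by (simp add: numeral_2_eq_2)
  from word_cong_append_left[OF R word_cong.sym[OF this], of "[i, j]"]
  have "([i, j], [i, j, j, i, j, i]) \<in> word_cong I (coxeter_relations I m)"
    using assms by simp
  also have "([i, j, j, i, j, i], [i, i, j, i]) \<in> word_cong I (coxeter_relations I m)"
    using word_cong_context[OF R square[OF assms(3)], of "[i]" "[i, j, i]"] assms by simp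
  also have "([i, i, j, i], [j, i]) \<in> word_cong I (coxeter_relations I m)"
    using word_cong_context[OF R square[OF assms(2)], of "[]" "[j, i]"] assms by simp
  finally show ?thesis .
qed

context
  fixes I :: "'a set" and m :: "'a \<Rightarrow> 'a \<Rightarrow> enat" and J :: "'a set"
  assumes m: "coxeter_matrix I m" and J: "J \<subseteq> I"
    and commuting: "\<forall>x\<in>J. \<forall>y\<in>J. x \<noteq> y \<longrightarrow> m x y = 2"
begin

text \<open>By induction only the first letter \<open>x\<close> can be repeated. It commutes with
  the letters before its other occurrence, and the two copies then cancel as a square.\<close>

lemma commuting_word_distinct:
  assumes "u \<in> lists J"
  shows "\<exists>v\<in>lists J. distinct v \<and> (u, v) \<in> word_cong I (coxeter_relations I m)"
  using assms
proof (induction u)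
  case Nil
  show ?case by (intro bexI[of _ "[]"]) (auto intro: word_cong.refl)
next
  case (Cons x u)
  note R = coxeter_relations_lists[of I m] and [trans] = word_cong.trans
  obtain v where v: "v \<in> lists J" "distinct v" "(u, v) \<in> word_cong I (coxeter_relations I m)"
    using Cons by auto
  have xv: "(x # u, x # v) \<in> word_cong I (coxeter_relations I m)"
    using word_cong_append_left[OF R v(3), of "[x]"] Cons J by auto
  show ?case
  proof (cases "x \<in> set v")
    case False
    then show ?thesis
      using v xv Cons by (intro bexI[of _ "x # v"]) auto
  next
    case True
    then obtain a b where ab: "v = a @ x # b" by (auto simp: in_set_conv_decomp)
    have comm: "(x # a, a @ [x]) \<in> word_cong I (coxeter_relations I m)"
      using v ab Cons J m commuting
      by (intro word_cong_commute_letter[OF R] ballI coxeter_cong_commute) auto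
    note xv
    also from comm have "(x # v, a @ [x, x] @ b) \<in> word_cong I (coxeter_relations I m)"
      using word_cong_append_right[OF R, of "x # a" "a @ [x]" "x # b"] v ab J by auto
    also have "(a @ [x, x] @ b, a @ [] @ b) \<in> word_cong I (coxeter_relations I m)"
      using v ab Cons J m by (intro word_cong_context[OF R] coxeter_cong_square) auto
    finally show ?thesis
      using v ab by (intro bexI[of _ "a @ b"]) auto
  qed
qed

text \<open>\<open>generate\<close> also admits inverses of generators, but the generators are
  involutions, so words without inverses suffice.\<close>

lemma parabolic_words: "parabolic I m J = coxeter_elt I m ` lists J"
proof
  note R = coxeter_relations_lists[of I m]
  interpret group "coxeter_group I m" by (rule group_coxeter_group[OF m])
  have lists: "lists J \<subseteq> lists I" using J by (rule lists_mono)
  show "parabolic I m J \<subseteq> coxeter_elt I m ` lists J"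
  proof
    fix w assume "w \<in> parabolic I m J"
    then show "w \<in> coxeter_elt I m ` lists J"
      unfolding parabolic_def
    proof (induction rule: generate.induct)
      case one
      then show ?case by (auto simp: one_presented_monoid[OF R])
    next
      case (incl h)
      then show ?case by auto
    next
      case (inv h)
      then obtain j where j: "j \<in> J" "h = coxeter_elt I m [j]" by auto
      then have jI: "j \<in> I" using J by auto
      then have "h \<otimes>\<^bsub>coxeter_group I m\<^esub> h = \<one>\<^bsub>coxeter_group I m\<^esub>"
        using coxeter_cong_square[OF m] j
        by (simp add: mult_presented_monoid[OF R] one_presented_monoid[OF R] word_class_eq_iff[OF R])
      then have "inv\<^bsub>coxeter_group I m\<^esub> h = h"
        using j jI by (intro inv_equality) (auto simp: carrier_presented_monoid[OF R])
      then show ?case using j by auto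
    next
      case (eng h1 h2)
      then obtain u v where uv: "u \<in> lists J" "v \<in> lists J"
        and h: "h1 = coxeter_elt I m u" "h2 = coxeter_elt I m v"
        by blast
      then have "h1 \<otimes>\<^bsub>coxeter_group I m\<^esub> h2 = coxeter_elt I m (u @ v)"
        using lists mult_presented_monoid[OF R] by blast
      then show ?case using uv by (metis append_in_lists_conv imageI)
    qed
  qed
  show "coxeter_elt I m ` lists J \<subseteq> parabolic I m J"
  proof (rule image_subsetI)
    fix u assume "u \<in> lists J"
    then show "coxeter_elt I m u \<in> parabolic I m J"
      unfolding parabolic_def
    proof (induction u)
      case Nil
      show ?case
        using generate.one[of "coxeter_group I m"] by (simp add: one_presented_monoid[OF R])
    next
      case (Cons j u)
      have "coxeter_elt I m [j] \<otimes>\<^bsub>coxeter_group I m\<^esub> coxeter_elt I m u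
          \<in> generate (coxeter_group I m) ((\<lambda>j. coxeter_elt I m [j]) ` J)"
        using Cons by (intro generate.eng[OF generate.incl]) auto
      moreover have "[j] \<in> lists I" "u \<in> lists I" using Cons J by auto
      ultimately show ?case
        by (simp add: mult_presented_monoid[OF R])
    qed
  qed
qed

text \<open>Every element is represented by a word without repetitions over the finite set
  \<open>J\<close>, and there are finitely many such words.\<close>

lemma finite_type_commuting: "finite_type I m J"
proof -
  have fin: "finite J" using m J by (auto simp: coxeter_matrix_def finite_subset)
  have "parabolic I m J \<subseteq> coxeter_elt I m ` {v. set v \<subseteq> J \<and> length v \<le> card J}"
  proof
    fix w assume "w \<in> parabolic I m J"
    then obtain u where u: "u \<in> lists J" "w = coxeter_elt I m u" by (auto simp: parabolic_words)
    then obtain v where v: "v \<in> lists J" "distinct v" "(u, v) \<in> word_cong I (coxeter_relations I m)"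
      using commuting_word_distinct by blast
    then have "w = coxeter_elt I m v"
      using u word_class_eq_iff[OF coxeter_relations_lists] word_cong_lists[OF coxeter_relations_lists]
      by metis
    moreover have "length v \<le> card J"
      using v fin by (metis card_mono distinct_card in_lists_conv_set subsetI)
    ultimately show "w \<in> coxeter_elt I m ` {v. set v \<subseteq> J \<and> length v \<le> card J}"
      using v by auto
  qed
  then have "finite (parabolic I m J)"
    by (rule finite_subset) (intro finite_imageI finite_lists_length_le[OF fin])
  then show ?thesis using J by (simp add: finite_type_def)
qed

text \<open>Words without repetitions bound all lengths in the parabolic subgroup by
  \<open>card J\<close>; \<open>reduced_commuting\<close> shows that \<open>u\<close> attains the
  bound.\<close>

lemma longest_element_commuting:
  assumes u: "distinct u" "set u = J"
  shows "is_longest_element I m J (coxeter_elt I m u)"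
proof -
  have uI: "u \<in> lists I" using u J by auto
  have len: "coxeter_length (coxeter_elt I m u) = card J"
    using reduced_commuting[OF m uI] u commuting by (auto simp: reduced_expression_def distinct_card)
  have "coxeter_length w \<le> card J" if "w \<in> parabolic I m J" for w
  proof -
    obtain x where x: "x \<in> lists J" "w = coxeter_elt I m x" using \<open>w \<in> _\<close> by (auto simp: parabolic_words)
    then obtain v where v: "v \<in> lists J" "distinct v" "(x, v) \<in> word_cong I (coxeter_relations I m)"
      using commuting_word_distinct by blast
    then have w: "w = coxeter_elt I m v"
      using x word_class_eq_iff[OF coxeter_relations_lists] word_cong_lists[OF coxeter_relations_lists]
      by metis
    have "length v \<le> card J"
      using v u by (metis List.finite_set card_mono distinct_card in_lists_conv_set subsetI)
    moreover have "v \<in> lists I" using v J by auto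
    ultimately show ?thesis
      using coxeter_length_le[of v I m] w by simp
  qed
  moreover have "coxeter_elt I m u \<in> parabolic I m J"
    using u by (auto simp: parabolic_words)
  ultimately show ?thesis
    using len by (auto simp: is_longest_element_def is_arg_max_def not_less)
qed

end

text \<open>Provides the condition on generators in \<open>standard_hom\<close>, with
  \<open>J = set u\<close> and with \<open>u\<close> itself as the reduced expression of the longest
  element.\<close>

lemma longest_artin_lift_commuting:
  assumes "coxeter_matrix I m" "u \<in> lists I"
    and "distinct u" "\<forall>x\<in>set u. \<forall>y\<in>set u. x \<noteq> y \<longrightarrow> m x y = 2"
  shows "\<exists>J w. finite_type I m J \<and> is_longest_element I m J w \<and> is_artin_lift I m w (artin_elt I m u)"
proof -
  have u: "set u \<subseteq> I" using assms(2) by auto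
  have "is_artin_lift I m (coxeter_elt I m u) (artin_elt I m u)"
    using reduced_commuting[OF assms] by (auto simp: is_artin_lift_def)
  then show ?thesis
    using finite_type_commuting[OF assms(1) u assms(4)]
      longest_element_commuting[OF assms(1) u assms(4,3) HOL.refl] by (intro exI conjI)
qed

section \<open>Braid relations between bipartite halves\<close>

context
  fixes I :: "'a set" and R :: "('a list \<times> 'a list) set"
  assumes R: "R \<subseteq> lists I \<times> lists I"
begin

text \<open>For generators of type A3 with central node \<open>a\<close> the word \<open>abc\<close>
  is a bipartite Coxeter element and the Coxeter number is 4, so both sides express the longest
  element. The proof is an explicit chain of moves between these expressions.\<close>

lemma braid4_of_A3:
  assumes "a \<in> lists I" "b \<in> lists I" "c \<in> lists I"
    and ab: "(a @ b @ a, b @ a @ b) \<in> word_cong I R" and ac: "(a @ c @ a, c @ a @ c) \<in> word_cong I R"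
    and bc: "(b @ c, c @ b) \<in> word_cong I R"
  shows "(a @ (b @ c) @ a @ (b @ c), (b @ c) @ a @ (b @ c) @ a) \<in> word_cong I R"
proof -
  note [trans] = word_cong.trans
  \<comment> \<open>\<open>step(1)\<close> applies a relation inside a word from left to right,
    \<open>step(2)\<close> from right to left.\<close>
  note step = word_cong_context[OF R] word_cong_context[OF R word_cong.sym]
  have "(a @ b @ c @ a @ b @ c, a @ b @ c @ a @ c @ b) \<in> word_cong I R"
    using step(1)[OF bc, of "a @ b @ c @ a" "[]"] assms by auto
  also have "(a @ b @ c @ a @ c @ b, a @ b @ a @ c @ a @ b) \<in> word_cong I R"
    using step(2)[OF ac, of "a @ b" "b"] assms by auto
  also have "(a @ b @ a @ c @ a @ b, b @ a @ b @ c @ a @ b) \<in> word_cong I R"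
    using step(1)[OF ab, of "[]" "c @ a @ b"] assms by auto
  also have "(b @ a @ b @ c @ a @ b, b @ a @ c @ b @ a @ b) \<in> word_cong I R"
    using step(1)[OF bc, of "b @ a" "a @ b"] assms by auto
  also have "(b @ a @ c @ b @ a @ b, b @ a @ c @ a @ b @ a) \<in> word_cong I R"
    using step(2)[OF ab, of "b @ a @ c" "[]"] assms by auto
  also have "(b @ a @ c @ a @ b @ a, b @ c @ a @ c @ b @ a) \<in> word_cong I R"
    using step(1)[OF ac, of "b" "b @ a"] assms by auto
  also have "(b @ c @ a @ c @ b @ a, b @ c @ a @ b @ c @ a) \<in> word_cong I R"
    using step(2)[OF bc, of "b @ c @ a" "a"] assms by auto
  finally show ?thesis by simp
qed

text \<open>Type \<open>D\<^sub>4\<close> reduces to this by taking for \<open>q\<close> the product of two leaves, which satisfies the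
  braid relation of length \<open>4\<close> with the central node \<open>a\<close> by the previous lemma.\<close>

lemma braid6_of_B3:
  assumes "a \<in> lists I" "q \<in> lists I" "d \<in> lists I"
    and aq: "(a @ q @ a @ q, q @ a @ q @ a) \<in> word_cong I R"
    and ad: "(a @ d @ a, d @ a @ d) \<in> word_cong I R"
    and qd: "(q @ d, d @ q) \<in> word_cong I R"
  shows "(a @ (q @ d) @ a @ (q @ d) @ a @ (q @ d), (q @ d) @ a @ (q @ d) @ a @ (q @ d) @ a)
    \<in> word_cong I R"
proof -
  note [trans] = word_cong.trans
  note step = word_cong_context[OF R] word_cong_context[OF R word_cong.sym]
  have "(a @ q @ d @ a @ q @ d @ a @ q @ d, a @ q @ d @ a @ d @ q @ a @ q @ d) \<in> word_cong I R"
    using step(1)[OF qd, of "a @ q @ d @ a" "a @ q @ d"] assms by auto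
  also have "(a @ q @ d @ a @ d @ q @ a @ q @ d, a @ q @ a @ d @ a @ q @ a @ q @ d) \<in> word_cong I R"
    using step(2)[OF ad, of "a @ q" "q @ a @ q @ d"] assms by auto
  also have "(a @ q @ a @ d @ a @ q @ a @ q @ d, a @ q @ a @ d @ q @ a @ q @ a @ d) \<in> word_cong I R"
    using step(1)[OF aq, of "a @ q @ a @ d" "d"] assms by auto
  also have "(a @ q @ a @ d @ q @ a @ q @ a @ d, a @ q @ a @ q @ d @ a @ q @ a @ d) \<in> word_cong I R"
    using step(2)[OF qd, of "a @ q @ a" "a @ q @ a @ d"] assms by auto
  also have "(a @ q @ a @ q @ d @ a @ q @ a @ d, q @ a @ q @ a @ d @ a @ q @ a @ d) \<in> word_cong I R"
    using step(1)[OF aq, of "[]" "d @ a @ q @ a @ d"] assms by auto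
  also have "(q @ a @ q @ a @ d @ a @ q @ a @ d, q @ a @ q @ d @ a @ d @ q @ a @ d) \<in> word_cong I R"
    using step(1)[OF ad, of "q @ a @ q" "q @ a @ d"] assms by auto
  also have "(q @ a @ q @ d @ a @ d @ q @ a @ d, q @ a @ q @ d @ a @ q @ d @ a @ d) \<in> word_cong I R"
    using step(2)[OF qd, of "q @ a @ q @ d @ a" "a @ d"] assms by auto
  also have "(q @ a @ q @ d @ a @ q @ d @ a @ d, q @ a @ q @ d @ a @ q @ a @ d @ a) \<in> word_cong I R"
    using step(2)[OF ad, of "q @ a @ q @ d @ a @ q" "[]"] assms by auto
  also have "(q @ a @ q @ d @ a @ q @ a @ d @ a, q @ a @ d @ q @ a @ q @ a @ d @ a) \<in> word_cong I R"
    using step(1)[OF qd, of "q @ a" "a @ q @ a @ d @ a"] assms by auto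
  also have "(q @ a @ d @ q @ a @ q @ a @ d @ a, q @ a @ d @ a @ q @ a @ q @ d @ a) \<in> word_cong I R"
    using step(2)[OF aq, of "q @ a @ d" "d @ a"] assms by auto
  also have "(q @ a @ d @ a @ q @ a @ q @ d @ a, q @ d @ a @ d @ q @ a @ q @ d @ a) \<in> word_cong I R"
    using step(1)[OF ad, of "q" "q @ a @ q @ d @ a"] assms by auto
  also have "(q @ d @ a @ d @ q @ a @ q @ d @ a, q @ d @ a @ q @ d @ a @ q @ d @ a) \<in> word_cong I R"
    using step(2)[OF qd, of "q @ d @ a" "a @ q @ d @ a"] assms by auto
  finally show ?thesis by simp
qed

end

section \<open>Unfolding and folding\<close>

lemma coxeter_matrix_tits_matrix:
  assumes "coxeter_matrix I m" "\<forall>i\<in>I. d i > 0"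
  shows "coxeter_matrix I (tits_matrix m d)"
proof -
  have "tits_matrix m d i j = tits_matrix m d j i" if "i \<in> I" "j \<in> I" for i j
    using assms that by (simp add: coxeter_matrix_def tits_matrix_def mult.commute mult.left_commute)
  moreover have "2 \<le> tits_matrix m d i j" if "i \<in> I" "j \<in> I" "i \<noteq> j" for i j
    using assms that by (auto simp: coxeter_matrix_def tits_matrix_def numeral_eq_enat mult.assoc)
  moreover have "tits_matrix m d i i = 1" if "i \<in> I" for i
  proof -
    \<comment> \<open>This puts the diagonal into the first case of \<open>tits_matrix\<close>,
      which keeps the entry \<open>m i i\<close>.\<close>
    have "(1 :: enat) \<le> 2" by (simp add: one_enat_def numeral_eq_enat)
    then show ?thesis
      using assms that by (simp add: coxeter_matrix_def tits_matrix_def)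
  qed
  ultimately show ?thesis
    using assms by (simp add: coxeter_matrix_def)
qed

text \<open>The pairs \<open>(i, t)\<close> with \<open>t < d i\<close> are the copies of
  \<open>i\<close>. They are coded by natural numbers because the intermediate matrices of
  \<open>standard_chain\<close> are indexed by sets of these.\<close>

lemma exists_fibration:
  assumes "finite I"
  obtains K :: "nat set" and p :: "nat \<Rightarrow> 'a"
  where "finite K" "p ` K \<subseteq> I" "\<And>i. i \<in> I \<Longrightarrow> card {k\<in>K. p k = i} = d i"
proof -
  let ?S = "SIGMA i:I. {..<d i}"
  have "finite ?S" using assms by auto
  then obtain e :: "'a \<times> nat \<Rightarrow> nat" where e: "inj_on e ?S"
    using finite_imp_inj_to_nat_seg by metis
  define p where "p k = fst (inv_into ?S e k)" for k
  have p: "p (e x) = fst x" if "x \<in> ?S" for x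
    using e that by (simp only: p_def inv_into_f_f)
  have fib: "card {k \<in> e ` ?S. p k = i} = d i" if "i \<in> I" for i
  proof -
    have "{k \<in> e ` ?S. p k = i} = e ` ({i} \<times> {..<d i})"
      using p that by force
    moreover have "inj_on e ({i} \<times> {..<d i})"
      using e by (rule inj_on_subset) (use that in auto)
    ultimately show ?thesis by (simp add: card_image)
  qed
  show thesis
    by (rule that[of "e ` ?S" p]) (use \<open>finite ?S\<close> p fib in auto)
qed

definition cover_matrix :: "('a \<Rightarrow> 'a \<Rightarrow> enat) \<Rightarrow> ('b \<Rightarrow> 'a) \<Rightarrow> 'b \<Rightarrow> 'b \<Rightarrow> enat" where
  "cover_matrix m p k l = (if k = l then 1 else if p k = p l then 2 else m (p k) (p l))"

lemma coxeter_matrix_cover_matrix: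
  assumes "coxeter_matrix I m" "finite K" "p ` K \<subseteq> I"
  shows "coxeter_matrix K (cover_matrix m p)"
  using assms by (auto simp: coxeter_matrix_def cover_matrix_def image_subset_iff)

text \<open>The product of a fibre must be written as a word; copies of one index commute, so the
  sorted order is just one choice of reduced expression.\<close>

definition fibre_list :: "'b::linorder set \<Rightarrow> ('b \<Rightarrow> 'a) \<Rightarrow> 'a \<Rightarrow> 'b list" where
  "fibre_list K p i = sorted_list_of_set {k\<in>K. p k = i}"

lemma map_alternating: "map f (alternating i j n) = alternating (f i) (f j) n"
  by (induction n arbitrary: i j) auto

lemma alternating_same: "alternating i i n = replicate n i"
  by (induction n) auto

lemma concat_alternating_singletons: "concat (alternating [i] [j] n) = alternating i j n"
  by (induction n arbitrary: i j) auto

lemma artin_relation_word_cong: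
  assumes "i \<in> I" "j \<in> I" "i \<noteq> j" "m i j = enat n"
  shows "(alternating i j n, alternating j i n) \<in> word_cong I (artin_relations I m)"
  using assms by (intro word_cong_relation[OF artin_relations_lists]) (auto simp: artin_relations_def)

lemma enat_le_2_iff: "2 \<le> x \<Longrightarrow> x \<le> 2 \<longleftrightarrow> x = (2 :: enat)"
  by auto

section \<open>Relations preserved by the two factors\<close>

context
  fixes I :: "'a set" and m :: "'a \<Rightarrow> 'a \<Rightarrow> enat" and d :: "'a \<Rightarrow> nat"
    and K :: "nat set" and p :: "nat \<Rightarrow> 'a"
  assumes m: "coxeter_matrix I m" and d: "\<forall>i\<in>I. d i > 0"
    and K: "finite K" and p: "p ` K \<subseteq> I" and fib: "\<And>i. i \<in> I \<Longrightarrow> card {k\<in>K. p k = i} = d i"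
begin

abbreviation "fibre_word \<equiv> fibre_list K p"

abbreviation "cover_cong \<equiv> word_cong K (artin_relations K (cover_matrix m p))"

lemma fibre_word:
  "fibre_word i \<in> lists K" "set (fibre_word i) = {k\<in>K. p k = i}" "distinct (fibre_word i)"
  "i \<in> I \<Longrightarrow> length (fibre_word i) = d i"
  using K fib by (auto simp: fibre_list_def sorted_list_of_set.length_sorted_key_list_of_set)

lemma cover_commute:
  assumes "k \<in> K" "l \<in> K" "k \<noteq> l" "cover_matrix m p k l = 2"
  shows "([k, l], [l, k]) \<in> cover_cong"
  using artin_relation_word_cong[of k K l "cover_matrix m p" 2] assms
  by (simp add: numeral_2_eq_2 numeral_eq_enat)

lemma cover_braid:
  assumes "k \<in> K" "l \<in> K" "p k \<noteq> p l" "m (p k) (p l) = 3"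
  shows "([k] @ [l] @ [k], [l] @ [k] @ [l]) \<in> cover_cong"
  using artin_relation_word_cong[of k K l "cover_matrix m p" 3] assms
  by (auto simp: cover_matrix_def numeral_3_eq_3 numeral_eq_enat)

text \<open>The only copy \<open>a\<close> of \<open>i\<close> is joined by label 3 to each of the
  \<open>d j\<close> pairwise commuting copies of \<open>j\<close>. This is type A3 or D4 with
  centre \<open>a\<close>, and \<open>2 * d j\<close> is 4 or 6.\<close>

lemma unfold_braid_3:
  assumes "i \<in> I" "j \<in> I" "i \<noteq> j" "m i j = 3" "d i = 1" "d j \<in> {2, 3}"
  shows "(concat (map fibre_word (alternating i j (2 * d j))),
    concat (map fibre_word (alternating j i (2 * d j)))) \<in> cover_cong"
proof -
  note R = artin_relations_lists[of K "cover_matrix m p"]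
  obtain a where a: "fibre_word i = [a]"
    using fibre_word(4)[of i] assms by (auto simp: length_Suc_conv)
  have a': "a \<in> K" "p a = i" using fibre_word(2)[of i] a by auto
  have ax: "([a] @ [x] @ [a], [x] @ [a] @ [x]) \<in> cover_cong" if "x \<in> set (fibre_word j)" for x
    using that fibre_word(2)[of j] a' assms by (intro cover_braid) auto
  have xy: "([x, y], [y, x]) \<in> cover_cong"
    if "x \<in> set (fibre_word j)" "y \<in> set (fibre_word j)" "x \<noteq> y" for x y
    using that fibre_word(2)[of j] by (intro cover_commute) (auto simp: cover_matrix_def)
  have mem: "x \<in> K" if "x \<in> set (fibre_word j)" for x
    using that fibre_word(2)[of j] by auto
  consider "d j = 2" | "d j = 3" using assms by auto
  then show ?thesis
  proof cases
    case 1
    then obtain b c where bc: "fibre_word j = [b, c]"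
      using fibre_word(4)[of j] assms by (auto simp: length_Suc_conv numeral_2_eq_2)
    then have "b \<noteq> c" using fibre_word(3)[of j] by simp
    then have "([a] @ ([b] @ [c]) @ [a] @ ([b] @ [c]), ([b] @ [c]) @ [a] @ ([b] @ [c]) @ [a])
        \<in> cover_cong"
      using ax[of b] ax[of c] xy[of b c] mem a' bc by (intro braid4_of_A3[OF R]) auto
    then show ?thesis using a bc 1 by (simp add: numeral_eq_Suc)
  next
    case 2
    then obtain b c e where bc: "fibre_word j = [b, c, e]"
      using fibre_word(4)[of j] assms by (auto simp: length_Suc_conv numeral_3_eq_3)
    then have neq: "b \<noteq> c" "b \<noteq> e" "c \<noteq> e" using fibre_word(3)[of j] by simp_all
    have "([a] @ ([b] @ [c]) @ [a] @ ([b] @ [c]), ([b] @ [c]) @ [a] @ ([b] @ [c]) @ [a])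
        \<in> cover_cong"
      using ax[of b] ax[of c] xy[of b c] mem a' bc neq by (intro braid4_of_A3[OF R]) auto
    then have aq: "([a] @ [b, c] @ [a] @ [b, c], [b, c] @ [a] @ [b, c] @ [a]) \<in> cover_cong"
      by simp
    \<comment> \<open>The leaves \<open>b\<close> and \<open>c\<close> form the block
      \<open>q\<close> of \<open>braid6_of_B3\<close>; the third leaf \<open>e\<close> takes the
      role of its \<open>d\<close>.\<close>
    have qe: "([b, c] @ [e], [e] @ [b, c]) \<in> cover_cong"
      using xy[of b e] xy[of c e] mem bc neq by (intro word_cong_commute[OF R]) auto
    have "([a] @ ([b, c] @ [e]) @ [a] @ ([b, c] @ [e]) @ [a] @ ([b, c] @ [e]),
        ([b, c] @ [e]) @ [a] @ ([b, c] @ [e]) @ [a] @ ([b, c] @ [e]) @ [a]) \<in> cover_cong"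
      using aq ax[of e] qe mem a' bc by (intro braid6_of_B3[OF R]) auto
    then show ?thesis using a bc 2 by (simp add: numeral_eq_Suc)
  qed
qed

text \<open>Only finite labels of \<open>tits_matrix\<close> give relations. These are the label 2,
  labels kept since both multiplicities are 1, and labels 4 or 6 replacing 3.\<close>

lemma unfold_relation:
  assumes "(x, y) \<in> artin_relations I (tits_matrix m d)"
  shows "(concat (map fibre_word x), concat (map fibre_word y)) \<in> cover_cong"
proof -
  note R = artin_relations_lists[of K "cover_matrix m p"]
  obtain i j n where ij: "x = alternating i j n" "y = alternating j i n" "i \<in> I" "j \<in> I" "i \<noteq> j"
    and n: "tits_matrix m d i j = enat n"
    using assms by (auto simp: artin_relations_def)
  have sym: "m j i = m i j" and ge: "2 \<le> m i j" using m ij by (auto simp: coxeter_matrix_def)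
  consider "m i j = 2" "n = 2" | "d i * d j = 1" "m i j = enat n"
    | "m i j = 3" "d i * d j \<in> {2, 3}" "n = 2 * (d i * d j)"
    using n ge by (auto simp: tits_matrix_def enat_le_2_iff numeral_eq_enat mult.assoc split: if_splits)
  then show ?thesis
  proof cases
    case 1
    have "(fibre_word i @ fibre_word j, fibre_word j @ fibre_word i) \<in> cover_cong"
    proof (intro word_cong_commute[OF R] fibre_word(1) ballI cover_commute)
      fix k l assume "k \<in> set (fibre_word i)" "l \<in> set (fibre_word j)"
      then show "k \<in> K" "l \<in> K" "k \<noteq> l" "cover_matrix m p k l = 2"
        using fibre_word(2) ij 1 by (auto simp: cover_matrix_def)
    qed
    then show ?thesis using ij 1 by (simp add: numeral_2_eq_2)
  next
    case 2
    then have "length (fibre_word i) = 1" "length (fibre_word j) = 1" using fibre_word(4) ij by auto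
    then obtain k l where kl: "fibre_word i = [k]" "fibre_word j = [l]"
      by (auto simp: length_Suc_conv)
    then have kl': "k \<in> K" "l \<in> K" "p k = i" "p l = j"
      using fibre_word(2)[of i] fibre_word(2)[of j] by auto
    have "(alternating k l n, alternating l k n) \<in> cover_cong"
      using kl' ij 2 by (intro artin_relation_word_cong) (auto simp: cover_matrix_def)
    then show ?thesis
      using ij kl by (simp add: map_alternating concat_alternating_singletons)
  next
    case 3
    \<comment> \<open>A product 2 or 3 leaves no room for two factors that are at least 2, so one of
      the fibres is a single point.\<close>
    have "d i = 1 \<or> d j = 1"
    proof (rule ccontr)
      assume "\<not> ?thesis"
      moreover have "d i > 0" "d j > 0" using d ij by auto
      ultimately have "2 * 2 \<le> d i * d j" by (intro mult_le_mono) auto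
      then show False using 3 by auto
    qed
    then consider "d i = 1" "d j \<in> {2, 3}" | "d j = 1" "d i \<in> {2, 3}"
      using 3 by auto
    then show ?thesis
    proof cases
      case 1
      then show ?thesis using unfold_braid_3[of i j] ij 3 by simp
    next
      case 2
      then show ?thesis using unfold_braid_3[of j i] ij 3 sym by (simp add: word_cong.sym)
    qed
  qed
qed

text \<open>Copies of different indices carry the label of these indices, so a relation becomes a
  relation. For two copies of the same index both sides become the same power of one
  generator.\<close>

lemma fold_relation:
  assumes "(x, y) \<in> artin_relations K (cover_matrix m p)"
  shows "(concat (map (\<lambda>k. [p k]) x), concat (map (\<lambda>k. [p k]) y)) \<in> word_cong I (artin_relations I m)"
proof -
  obtain k l n where kl: "x = alternating k l n" "y = alternating l k n" "k \<in> K" "l \<in> K" "k \<noteq> l"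
    "cover_matrix m p k l = enat n"
    using assms by (auto simp: artin_relations_def)
  have pI: "p k \<in> I" "p l \<in> I" using p kl by auto
  show ?thesis
  proof (cases "p k = p l")
    case True
    then show ?thesis
      using kl pI by (auto simp: map_alternating alternating_same intro!: word_cong.refl)
  next
    case False
    then show ?thesis
      using kl pI artin_relation_word_cong[of "p k" I "p l" m n]
      by (simp add: map_alternating concat_alternating_singletons cover_matrix_def)
  qed
qed

section \<open>The two standard factors and their composite\<close>

abbreviation "unfold_hom \<equiv> word_subst_hom K (artin_relations K (cover_matrix m p)) fibre_word"

abbreviation "fold_hom \<equiv> word_subst_hom I (artin_relations I m) (\<lambda>k. [p k])"

lemma unfold_hom_elt:
  "i \<in> I \<Longrightarrow> unfold_hom (artin_elt I (tits_matrix m d) [i]) = artin_elt K (cover_matrix m p) (fibre_word i)"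
  using word_subst_hom_word_class[OF artin_relations_lists artin_relations_lists fibre_word(1) unfold_relation,
      where u = "[i]"]
  by simp

lemma fold_hom_elt:
  "u \<in> lists K \<Longrightarrow> fold_hom (artin_elt K (cover_matrix m p) u) = artin_elt I m (map p u)"
proof -
  assume u: "u \<in> lists K"
  have "[p k] \<in> lists I" if "k \<in> K" for k using that p by auto
  from word_subst_hom_word_class[OF artin_relations_lists artin_relations_lists this fold_relation u]
  show ?thesis by simp
qed

lemma standard_hom_unfold: "standard_hom I (tits_matrix m d) K (cover_matrix m p) unfold_hom"
  unfolding standard_hom_def
proof (intro conjI ballI)
  show cK: "coxeter_matrix K (cover_matrix m p)"
    using m K p by (rule coxeter_matrix_cover_matrix)
  show "coxeter_matrix I (tits_matrix m d)"
    using m d by (rule coxeter_matrix_tits_matrix)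
  show "monoid_hom (artin_monoid I (tits_matrix m d)) (artin_monoid K (cover_matrix m p)) unfold_hom"
    using artin_relations_lists artin_relations_lists fibre_word(1) unfold_relation
    by (rule monoid_hom_word_subst_hom)
  fix i assume "i \<in> I"
  moreover have "\<forall>k\<in>set (fibre_word i). \<forall>l\<in>set (fibre_word i). k \<noteq> l \<longrightarrow> cover_matrix m p k l = 2"
    using fibre_word(2) by (auto simp: cover_matrix_def)
  ultimately show "\<exists>J w. finite_type K (cover_matrix m p) J \<and> is_longest_element K (cover_matrix m p) J w \<and>
      is_artin_lift K (cover_matrix m p) w (unfold_hom (artin_elt I (tits_matrix m d) [i]))"
    using longest_artin_lift_commuting[OF cK fibre_word(1,3)] by (simp only: unfold_hom_elt)
qed

lemma standard_hom_fold: "standard_hom K (cover_matrix m p) I m fold_hom"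
  unfolding standard_hom_def
proof (intro conjI ballI)
  show "coxeter_matrix K (cover_matrix m p)"
    using m K p by (rule coxeter_matrix_cover_matrix)
  show "coxeter_matrix I m" by (rule m)
  show "monoid_hom (artin_monoid K (cover_matrix m p)) (artin_monoid I m) fold_hom"
    using p by (intro monoid_hom_word_subst_hom artin_relations_lists fold_relation) auto
  fix k assume "k \<in> K"
  then have "fold_hom (artin_elt K (cover_matrix m p) [k]) = artin_elt I m [p k]" "[p k] \<in> lists I"
    using fold_hom_elt[of "[k]"] p by auto
  \<comment> \<open>A single letter is a repetition-free word in commuting letters, which gives
    \<open>J = {p k}\<close>.\<close>
  then show "\<exists>J w. finite_type I m J \<and> is_longest_element I m J w \<and>
      is_artin_lift I m w (fold_hom (artin_elt K (cover_matrix m p) [k]))"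
    using longest_artin_lift_commuting[OF m, of "[p k]"] by simp
qed

lemma tits_hom_fold_unfold: "tits_hom I m d (fold_hom \<circ> unfold_hom)"
  unfolding tits_hom_def
proof (intro conjI ballI)
  have "monoid_hom (artin_monoid I (tits_matrix m d)) (artin_monoid K (cover_matrix m p)) unfold_hom"
    "monoid_hom (artin_monoid K (cover_matrix m p)) (artin_monoid I m) fold_hom"
    using standard_hom_unfold standard_hom_fold by (auto simp: standard_hom_def)
  then show "monoid_hom (artin_monoid I (tits_matrix m d)) (artin_monoid I m) (fold_hom \<circ> unfold_hom)"
    by (rule monoid_hom_comp)
  fix i assume i: "i \<in> I"
  \<comment> \<open>The word of the fibre has \<open>d i\<close> letters, all lying over
    \<open>i\<close>.\<close>
  have "map p (fibre_word i) = replicate (d i) i"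
    using i fibre_word by (auto intro!: replicate_eqI)
  then show "(fold_hom \<circ> unfold_hom) (artin_elt I (tits_matrix m d) [i]) =
      artin_elt I m [i] [^]\<^bsub>artin_monoid I m\<^esub> d i"
    using i by (simp only: comp_apply unfold_hom_elt fold_hom_elt fibre_word(1)
        word_class_pow[OF artin_relations_lists])
qed

end

section \<open>Uniqueness of the Tits homomorphism and its factorisation\<close>

text \<open>This passes the factorisation from one map to every Tits homomorphism. Maps are
  arbitrary outside the carrier, and the composite case of \<open>Ast_morphism\<close> asks for
  equality on the carrier only.\<close>

lemma tits_hom_unique:
  assumes "tits_hom I m d \<Phi>" "tits_hom I m d \<Psi>" "X \<in> carrier (artin_monoid I (tits_matrix m d))"
  shows "\<Phi> X = \<Psi> X"
proof (rule monoid_hom_presented_eqI[OF artin_relations_lists _ _ _ assms(3)])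
  show "monoid_hom (artin_monoid I (tits_matrix m d)) (artin_monoid I m) \<Phi>"
    "monoid_hom (artin_monoid I (tits_matrix m d)) (artin_monoid I m) \<Psi>"
    using assms by (simp_all add: tits_hom_def)
qed (use assms in \<open>simp add: tits_hom_def\<close>)

theorem theorem4p19:
  fixes I :: "'a set" and m :: "'a \<Rightarrow> 'a \<Rightarrow> enat" and d :: "'a \<Rightarrow> nat"
  assumes "coxeter_matrix I m"
    and "\<forall>i\<in>I. d i > 0"
  shows "(\<exists>\<Phi>. tits_hom I m d \<Phi>) \<and>
    (\<forall>\<Phi>. tits_hom I m d \<Phi> \<longrightarrow> Ast_morphism I (tits_matrix m d) I m \<Phi>)"
proof -
  have "finite I" using assms(1) by (simp add: coxeter_matrix_def)
  then obtain K :: "nat set" and p :: "nat \<Rightarrow> 'a" where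
    Kp: "finite K" "p ` K \<subseteq> I" "\<And>i. i \<in> I \<Longrightarrow> card {k\<in>K. p k = i} = d i"
    using exists_fibration[of I d] by metis
  let ?unfold = "word_subst_hom K (artin_relations K (cover_matrix m p)) (fibre_list K p)"
  let ?fold = "word_subst_hom I (artin_relations I m) (\<lambda>k. [p k])"
  have tits: "tits_hom I m d (?fold \<circ> ?unfold)"
    using assms Kp by (rule tits_hom_fold_unfold)
  have unfold: "standard_hom I (tits_matrix m d) K (cover_matrix m p) ?unfold"
    using assms Kp by (rule standard_hom_unfold)
  have fold: "standard_hom K (cover_matrix m p) I m ?fold"
    using assms Kp by (rule standard_hom_fold)
  show ?thesis
  proof (intro conjI allI impI)
    show "\<exists>\<Phi>. tits_hom I m d \<Phi>" using tits by blast
    fix \<Phi> assume "tits_hom I m d \<Phi>"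
    then have "\<Phi> X = (?fold \<circ> ?unfold) X"
      if "X \<in> carrier (artin_monoid I (tits_matrix m d))" for X
      using tits that by (rule tits_hom_unique)
    \<comment> \<open>The chain before the last factor consists of \<open>?unfold\<close>
      alone.\<close>
    then show "Ast_morphism I (tits_matrix m d) I m \<Phi>"
      unfolding Ast_morphism_def comp_apply
      using standard_chain.single[OF unfold] fold by blast
  qed
qed

end
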